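(* Let $X$ be a regular topological space, let $\mathcal{I}$ be an ideal on $\omega$, and let $\bm{x}=(x_n)_{n\in\omega}$ be a sequence taking values in $X$ such that $\{n\in\omega: x_n\notin K\}\in\mathcal{I}$ for some compact set $K\subseteq X$. Let $\mathscr{F}=\{F_\eta:\eta\in X\}$ be a rough family such that every $F_\eta$ is closed. Then $$\mathsf{L}_{\bm{x}}(\mathcal{I},\mathscr{F})=\left\{\eta\in X:\Gamma_{\bm{x}}(\mathcal{I})\subseteq F_\eta\right\}.$$
   Context: $\omega$ denotes the set of nonnegative integers. An ideal on $\omega$ is a family $\mathcal{I}\subseteq\mathcal{P}(\omega)$ closed under subsets and finite unions, containing all finite subsets of $\omega$, and with $\omega\notin\mathcal{I}$. Topological spaces are not assumed to be Hausdorff. Regular means that a closed set and a point outside it can be separated by disjoint open sets. A rough family on a topological space $X$ is a collection $\mathscr{F}=\{F_\eta:\eta\in X\}$ of subsets of $X$ such that $\eta\in F_\eta$ for all $\eta\in X$. A sequence $(x_n)_{n\in\omega}$ in $X$ is $\mathcal{I}$-convergent to $\eta\in X$ with roughness $\mathscr{F}$, written $(\mathcal{I},\mathscr{F})\text{-}\lim_n x_n=\eta$, if $\{n\in\omega: x_n\notin U\}\in\mathcal{I}$ for all open sets $U\subseteq X$ with $F_\eta\subseteq U$. The set of all such limits is $\mathsf{L}_{\bm{x}}(\mathcal{I},\mathscr{F}):=\{\eta\in X:(\mathcal{I},\mathscr{F})\text{-}\lim_n x_n=\eta\}$. A point $\eta\in X$ is an $\mathcal{I}$-cluster point of $\bm{x}=(x_n)$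 if $\{n\in\omega: x_n\in U\}\notin\mathcal{I}$ for all open sets $U$ containing $\eta$; $\Gamma_{\bm{x}}(\mathcal{I})$ denotes the set of $\mathcal{I}$-cluster points of $\bm{x}$. *)

theory Defs
  imports "HOL-Analysis.Analysis"
begin

definition ideal_on_nat :: "nat set set \<Rightarrow> bool" where
  "ideal_on_nat I \<longleftrightarrow>
     (\<forall>A B. A \<in> I \<longrightarrow> B \<subseteq> A \<longrightarrow> B \<in> I) \<and>
     (\<forall>A B. A \<in> I \<longrightarrow> B \<in> I \<longrightarrow> A \<union> B \<in> I) \<and>
     (\<forall>A. finite A \<longrightarrow> A \<in> I) \<and>
     UNIV \<notin> I"

text \<open>The values of \<open>F\<close> outside \<open>topspace X\<close> are irrelevant.\<close>

definition rough_family :: "'a topology \<Rightarrow> ('a \<Rightarrow> 'a set) \<Rightarrow> bool" where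
  "rough_family X F \<longleftrightarrow> (\<forall>\<eta>\<in>topspace X. F \<eta> \<subseteq> topspace X \<and> \<eta> \<in> F \<eta>)"

definition rough_ideal_convergent ::
    "'a topology \<Rightarrow> nat set set \<Rightarrow> ('a \<Rightarrow> 'a set) \<Rightarrow> (nat \<Rightarrow> 'a) \<Rightarrow> 'a \<Rightarrow> bool" where
  "rough_ideal_convergent X I F x \<eta> \<longleftrightarrow>
     \<eta> \<in> topspace X \<and> (\<forall>U. openin X U \<longrightarrow> F \<eta> \<subseteq> U \<longrightarrow> {n. x n \<notin> U} \<in> I)"

definition rough_limits ::
    "'a topology \<Rightarrow> nat set set \<Rightarrow> ('a \<Rightarrow> 'a set) \<Rightarrow> (nat \<Rightarrow> 'a) \<Rightarrow> 'a set" where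
  "rough_limits X I F x = {\<eta> \<in> topspace X. rough_ideal_convergent X I F x \<eta>}"

definition ideal_cluster_point ::
    "'a topology \<Rightarrow> nat set set \<Rightarrow> (nat \<Rightarrow> 'a) \<Rightarrow> 'a \<Rightarrow> bool" where
  "ideal_cluster_point X I x \<eta> \<longleftrightarrow>
     \<eta> \<in> topspace X \<and> (\<forall>U. openin X U \<longrightarrow> \<eta> \<in> U \<longrightarrow> {n. x n \<in> U} \<notin> I)"

definition ideal_cluster_points ::
    "'a topology \<Rightarrow> nat set set \<Rightarrow> (nat \<Rightarrow> 'a) \<Rightarrow> 'a set" where
  "ideal_cluster_points X I x = {\<eta> \<in> topspace X. ideal_cluster_point X I x \<eta>}"

end

theory Submission
  imports Defs
begin

text \<open>Both inclusions come from separating cluster points from \<open>F \<eta>\<close>. If a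
  cluster point lies outside the closed set \<open>F \<eta>\<close>, regularity gives it a
  neighbourhood disjoint from an open superset of \<open>F \<eta>\<close>; convergence makes that
  neighbourhood negligible, a contradiction (\<open>rough_limit_contains_cluster_points\<close>).
  Conversely, if \<open>F \<eta>\<close> contains all cluster points and \<open>U\<close> is an open
  superset of it, the part of \<open>K\<close> outside \<open>U\<close> is compact and free of
  cluster points, so the sequence visits it only on a set in \<open>I\<close>
  (\<open>compactin_no_cluster_points\<close>); the indices outside \<open>K\<close> are in
  \<open>I\<close> as well.\<close>

lemma ideal_on_nat_mono: "ideal_on_nat I \<Longrightarrow> A \<in> I \<Longrightarrow> B \<subseteq> A \<Longrightarrow> B \<in> I"
  unfolding ideal_on_nat_def by blast

lemma ideal_on_nat_Un: "ideal_on_nat I \<Longrightarrow> A \<in> I \<Longrightarrow> B \<in> I \<Longrightarrow> A \<union> B \<in> I"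
  unfolding ideal_on_nat_def by blast

lemma ideal_on_nat_Union:
  assumes "ideal_on_nat I" "finite \<A>" "\<A> \<subseteq> I"
  shows "\<Union>\<A> \<in> I"
  using assms(2,3)
proof (induction \<A> rule: finite_induct)
  case empty
  then show ?case using assms(1) by (simp add: ideal_on_nat_def)
next
  case (insert A \<A>)
  then show ?case using ideal_on_nat_Un[OF assms(1)] by simp
qed

text \<open>Negligible open sets cover \<open>K\<close>, finitely many of them suffice, and ideals
  are closed under finite unions.\<close>

lemma compactin_no_cluster_points:
  assumes I: "ideal_on_nat I" and K: "compactin X K"
    and disj: "K \<inter> ideal_cluster_points X I x = {}"
  shows "{n. x n \<in> K} \<in> I"
proof -
  define \<W> where "\<W> = {W. openin X W \<and> {n. x n \<in> W} \<in> I}"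
  \<comment> \<open>A point of \<open>K\<close> is not a cluster point, and the open set witnessing
    this is a member of \<open>\<W>\<close>.\<close>
  have "K \<subseteq> \<Union>\<W>"
    using disj compactin_subset_topspace[OF K]
    unfolding \<W>_def ideal_cluster_points_def ideal_cluster_point_def by blast
  moreover have "\<forall>W\<in>\<W>. openin X W"
    by (simp add: \<W>_def)
  ultimately obtain \<F> where \<F>: "finite \<F>" "\<F> \<subseteq> \<W>" "K \<subseteq> \<Union>\<F>"
    using K unfolding compactin_def by meson
  have "\<Union>((\<lambda>W. {n. x n \<in> W}) ` \<F>) \<in> I"
    by (rule ideal_on_nat_Union[OF I]) (use \<F> in \<open>auto simp: \<W>_def\<close>)
  then show ?thesis
    by (rule ideal_on_nat_mono[OF I]) (use \<F>(3) in auto)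
qed

lemma rough_limit_contains_cluster_points:
  assumes "regular_space X" and I: "ideal_on_nat I"
    and cl: "closedin X (F \<eta>)" and lim: "rough_ideal_convergent X I F x \<eta>"
  shows "ideal_cluster_points X I x \<subseteq> F \<eta>"
proof (rule subsetI, rule ccontr)
  fix c assume c: "c \<in> ideal_cluster_points X I x" "c \<notin> F \<eta>"
  then have "c \<in> topspace X - F \<eta>"
    by (simp add: ideal_cluster_points_def)
  then obtain U V where UV: "openin X U" "openin X V" "c \<in> U" "F \<eta> \<subseteq> V" "disjnt U V"
    using assms(1) cl unfolding regular_space_def by meson
  have "{n. x n \<notin> V} \<in> I"
    using lim UV by (simp add: rough_ideal_convergent_def)
  \<comment> \<open>By disjointness, an index with \<open>x n\<close> in \<open>U\<close> has
    \<open>x n\<close> outside \<open>V\<close>.\<close>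
  then have "{n. x n \<in> U} \<in> I"
    by (rule ideal_on_nat_mono[OF I]) (use UV(5) in \<open>auto simp: disjnt_iff\<close>)
  then show False
    using c(1) UV by (auto simp: ideal_cluster_points_def ideal_cluster_point_def)
qed

text \<open>Outside an open \<open>U\<close> containing \<open>F \<eta>\<close>, the compact set
  \<open>K\<close> leaves a compact remainder that no cluster point can meet.\<close>

lemma rough_ideal_convergentI_compact:
  assumes I: "ideal_on_nat I" and K: "compactin X K" "{n. x n \<notin> K} \<in> I"
    and \<eta>: "\<eta> \<in> topspace X" and sub: "ideal_cluster_points X I x \<subseteq> F \<eta>"
  shows "rough_ideal_convergent X I F x \<eta>"
  unfolding rough_ideal_convergent_def
proof (intro conjI allI impI \<eta>)
  fix U assume U: "openin X U" "F \<eta> \<subseteq> U"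
  have "compactin X (K \<inter> (topspace X - U))"
    using K(1) U(1) by (intro compact_Int_closedin closedin_diff closedin_topspace)
  then have "{n. x n \<in> K \<inter> (topspace X - U)} \<in> I"
    by (rule compactin_no_cluster_points[OF I]) (use sub U(2) in auto)
  then have "{n. x n \<in> K \<inter> (topspace X - U)} \<union> {n. x n \<notin> K} \<in> I"
    using K(2) by (rule ideal_on_nat_Un[OF I])
  \<comment> \<open>A term outside \<open>U\<close> is either outside \<open>K\<close> or in
    \<open>K\<close>, hence in \<open>topspace X - U\<close>.\<close>
  then show "{n. x n \<notin> U} \<in> I"
    by (rule ideal_on_nat_mono[OF I]) (use compactin_subset_topspace[OF K(1)] in auto)
qed

theorem corollary1p4:
  fixes X :: "'a topology" and I :: "nat set set"
    and x :: "nat \<Rightarrow> 'a" and F :: "'a \<Rightarrow> 'a set"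
  assumes "regular_space X"
    and "ideal_on_nat I"
    and "\<And>n. x n \<in> topspace X"
    and "\<exists>K. compactin X K \<and> {n. x n \<notin> K} \<in> I"
    and "rough_family X F"
    and "\<And>\<eta>. \<eta> \<in> topspace X \<Longrightarrow> closedin X (F \<eta>)"
  shows "rough_limits X I F x = {\<eta> \<in> topspace X. ideal_cluster_points X I x \<subseteq> F \<eta>}"
proof -
  obtain K where K: "compactin X K" "{n. x n \<notin> K} \<in> I"
    using assms(4) by blast
  have "rough_ideal_convergent X I F x \<eta> \<longleftrightarrow> ideal_cluster_points X I x \<subseteq> F \<eta>"
    if "\<eta> \<in> topspace X" for \<eta>
    using rough_limit_contains_cluster_points[where F = F, OF assms(1,2) assms(6)[OF that]]
      rough_ideal_convergentI_compact[OF assms(2) K that] by blast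
  then show ?thesis
    unfolding rough_limits_def by blast
qed

end
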